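(* Let $Q$ be a quiver, let $\pi=\pi_1/\pi_2/\cdots/\pi_\ell$ be a set partition of $V(Q)$, and let $(\widehat{Q},\widehat{\pi})$ be the associated partitioned framed quiver. For each $1\le i\le \ell$ let $\sigma_i$ be a maximal green sequence for the framed component $\widehat{Q_i}=\widehat{(Q_i)}$. Let $\tau=(k_1,\dots,k_N)$ be a shuffle of $\sigma_1,\dots,\sigma_\ell$ such that for each $1\le t\le N$ the vertex $k_t$ is component preserving with respect to $\widehat\pi$ in $\mu_{k_{t-1}}\circ\cdots\circ\mu_{k_1}(\widehat{Q})$. Then $\tau$ is a maximal green sequence for $\widehat{Q}$.
   Context: A quiver $Q$ is a finite directed multigraph with vertex set $V(Q)$ and edge set $E(Q)$ (edges are called arrows) without loops or 2-cycles. An ice quiver is a quiver with a designated set $F\subseteq V(Q)$ of frozen vertices with no arrows between elements of $F$; the other vertices are mutable. The framed quiver $\widehat{Q}$ has vertex set $V(Q)\sqcup\{v' : v\in V(Q)\}$, arrows $E(Q)\sqcup\{v\to v' : v\in V(Q)\}$, and frozen vertices $\{v' : v\in V(Q)\}$. Mutation $\mu_i$ at a mutable vertex $i$: (1) for each pair of arrows $j\to i$, $i\to k$ with $j,k$ not both frozen, add an arrow $j\to k$; (2) reverse all arrows incident to $i$; (3) delete a maximal collection of disjoint 2-cycles. The frozen set is unchanged. In an ice quiver obtained from a framed quiver by mutations, a mutable vertex is green if there are no arrows to it from frozen vertices, and red if there are no arrows from it to frozen vertices. By sign-coherence (known) every mutable vertex is either green or red. A (finite) sequence of mutable vertices $(k_1,\dots,k_N)$,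 mutated at in this order starting from $\widehat Q$, is a reddening sequence (for $Q$, equivalently for $\widehat Q$) if all mutable vertices are red in the resulting quiver; it is a maximal green sequence if moreover each mutation is performed at a vertex that is green at that moment. Given a set partition $\pi=\pi_1/\cdots/\pi_\ell$ of $V(Q)$, the component $Q_i$ is the induced subquiver of $Q$ on $\pi_i$. The partition $\widehat\pi$ of $V(\widehat Q)$ has parts $\widehat{\pi_i}=\{v,v' : v\in\pi_i\}$; then $(\widehat{Q})_i=\widehat{(Q_i)}$. Mutation does not change the partition. Let $R$ be an ice quiver obtained from $\widehat Q$ by mutations, with partition $\widehat\pi$ and components $R_i$ (induced subquivers on $\widehat{\pi_i}$). A mutable vertex $k\in V(R_i)$ is component preserving with respect to $\widehat\pi$ if one of the following occurs: (i) there is an arrow $k\to j'$ with $j'$ frozen, and every arrow $a\to k$ of $R$ has $a\in V(R_i)$; or (ii) there is an arrow $j'\to k$ with $j'$ frozen, and every arrow $k\to a$ of $R$ has $a\in V(R_i)$. A shuffle of several sequences is a sequence whose entries are exactly those of the given sequences (as a multiset union), with the relative order of each given sequence preserved. *)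

theory Defs
  imports Main "HOL-Library.Disjoint_Sets"
begin

text \<open>
  A multigraph is given by its vertex set and, for every ordered pair of vertices,
  the number of arrows between them; this is the multigraph up to renaming of
  parallel arrows, which play no individual role under mutation.
\<close>

record 'v quiver =
  verts :: "'v set"
  arr :: "'v \<Rightarrow> 'v \<Rightarrow> nat"

record 'v ice_quiver = "'v quiver" +
  frozen :: "'v set"

locale quiver =
  fixes Q :: "('v, 'z) quiver_scheme"
  assumes finite_verts: "finite (verts Q)"
    and arr_verts: "arr Q a b > 0 \<Longrightarrow> a \<in> verts Q \<and> b \<in> verts Q"
    and no_loops: "arr Q a a = 0"
    and no_2cycles: "arr Q a b > 0 \<Longrightarrow> arr Q b a = 0"

locale ice_quiver = quiver R for R :: "('v, 'z) ice_quiver_scheme" +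
  assumes frozen_verts: "frozen R \<subseteq> verts R"
    and frozen_arr: "a \<in> frozen R \<Longrightarrow> b \<in> frozen R \<Longrightarrow> arr R a b = 0"

definition mutable :: "('v, 'z) ice_quiver_scheme \<Rightarrow> 'v set" where
  "mutable R = verts R - frozen R"

definition induced :: "'v quiver \<Rightarrow> 'v set \<Rightarrow> 'v quiver" where
  "induced Q S =
     \<lparr>verts = verts Q \<inter> S, arr = (\<lambda>a b. if a \<in> S \<and> b \<in> S then arr Q a b else 0)\<rparr>"

text \<open>In the framed quiver, \<open>Inl v\<close> is the vertex \<open>v\<close> and \<open>Inr v\<close> its frozen copy \<open>v'\<close>.\<close>

definition framed :: "'v quiver \<Rightarrow> ('v + 'v) ice_quiver" where
  "framed Q =
     \<lparr>verts = verts Q <+> verts Q,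
      arr = (\<lambda>a b. case (a, b) of
               (Inl v, Inl w) \<Rightarrow> arr Q v w
             | (Inl v, Inr w) \<Rightarrow> (if v = w \<and> v \<in> verts Q then 1 else 0)
             | _ \<Rightarrow> 0),
      frozen = Inr ` verts Q\<rparr>"

definition framed_partition :: "'v set set \<Rightarrow> ('v + 'v) set set" where
  "framed_partition P = (\<lambda>B. B <+> B) ` P"

definition add_paths :: "'v \<Rightarrow> ('v, 'z) ice_quiver_scheme \<Rightarrow> ('v, 'z) ice_quiver_scheme" where
  "add_paths i R = R\<lparr>arr := (\<lambda>j k. arr R j k +
     (if j \<in> frozen R \<and> k \<in> frozen R then 0 else arr R j i * arr R i k))\<rparr>"

definition reverse_at :: "'v \<Rightarrow> ('v, 'z) ice_quiver_scheme \<Rightarrow> ('v, 'z) ice_quiver_scheme" where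
  "reverse_at i R = R\<lparr>arr := (\<lambda>j k. if j = i \<or> k = i then arr R k j else arr R j k)\<rparr>"

text \<open>
  A maximal collection of disjoint 2-cycles between \<open>j\<close> and \<open>k\<close> uses
  \<open>min (arr R j k) (arr R k j)\<close> arrows in each direction; truncated subtraction
  gives what is left.
\<close>

definition cancel_2cycles :: "('v, 'z) ice_quiver_scheme \<Rightarrow> ('v, 'z) ice_quiver_scheme" where
  "cancel_2cycles R = R\<lparr>arr := (\<lambda>j k. arr R j k - arr R k j)\<rparr>"

definition mutate :: "'v \<Rightarrow> ('v, 'z) ice_quiver_scheme \<Rightarrow> ('v, 'z) ice_quiver_scheme" where
  "mutate i R = cancel_2cycles (reverse_at i (add_paths i R))"

definition green :: "('v, 'z) ice_quiver_scheme \<Rightarrow> 'v \<Rightarrow> bool" where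
  "green R k \<longleftrightarrow> k \<in> mutable R \<and> (\<forall>j\<in>frozen R. arr R j k = 0)"

definition red :: "('v, 'z) ice_quiver_scheme \<Rightarrow> 'v \<Rightarrow> bool" where
  "red R k \<longleftrightarrow> k \<in> mutable R \<and> (\<forall>j\<in>frozen R. arr R k j = 0)"

text \<open>
  \<open>fold mutate ks R\<close> mutates \<open>R\<close> at the entries of \<open>ks\<close>, the head of \<open>ks\<close> first.
\<close>

definition reddening_sequence :: "('v, 'z) ice_quiver_scheme \<Rightarrow> 'v list \<Rightarrow> bool" where
  "reddening_sequence R ks \<longleftrightarrow>
     set ks \<subseteq> mutable R \<and>
     (\<forall>v\<in>mutable (fold mutate ks R). red (fold mutate ks R) v)"

definition maximal_green_sequence :: "('v, 'z) ice_quiver_scheme \<Rightarrow> 'v list \<Rightarrow> bool" where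
  "maximal_green_sequence R ks \<longleftrightarrow>
     reddening_sequence R ks \<and>
     (\<forall>t<length ks. green (fold mutate (take t ks) R) (ks ! t))"

definition component_preserving ::
    "'v set set \<Rightarrow> ('v, 'z) ice_quiver_scheme \<Rightarrow> 'v \<Rightarrow> bool" where
  "component_preserving P R k \<longleftrightarrow>
     k \<in> mutable R \<and>
     (\<exists>B\<in>P. k \<in> B \<and>
        ((\<exists>j\<in>frozen R. arr R k j > 0) \<and> (\<forall>a. arr R a k > 0 \<longrightarrow> a \<in> B) \<or>
         (\<exists>j\<in>frozen R. arr R j k > 0) \<and> (\<forall>a. arr R k a > 0 \<longrightarrow> a \<in> B)))"

text \<open>Shuffles of several sequences, by iterating the binary \<^const>\<open>shuffles\<close>.\<close>

primrec multi_shuffles :: "'a list list \<Rightarrow> 'a list set" where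
  "multi_shuffles [] = {[]}"
| "multi_shuffles (xs # xss) = (\<Union>ys\<in>multi_shuffles xss. shuffles xs ys)"

lemma quiver_induced:
  assumes "quiver Q"
  shows "quiver (induced Q S)"
  using assms unfolding quiver_def induced_def by (auto split: if_splits)

lemma ice_quiver_framed:
  assumes "quiver Q"
  shows "ice_quiver (framed Q)"
  using assms unfolding ice_quiver_def ice_quiver_axioms_def quiver_def framed_def
  by (auto split: sum.splits if_splits)

lemma verts_mutate [simp]: "verts (mutate i R) = verts R"
  and frozen_mutate [simp]: "frozen (mutate i R) = frozen R"
  by (simp_all add: mutate_def cancel_2cycles_def reverse_at_def add_paths_def)

lemma ice_quiver_mutate:
  assumes "ice_quiver R" "i \<in> mutable R"
  shows "ice_quiver (mutate i R)"
proof -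
  interpret ice_quiver R by fact
  have arr: "arr (mutate i R) = (\<lambda>j k.
      arr (reverse_at i (add_paths i R)) j k - arr (reverse_at i (add_paths i R)) k j)"
    by (simp add: mutate_def cancel_2cycles_def)
  have supp0: "j \<in> verts R \<and> k \<in> verts R"
    if "arr (reverse_at i (add_paths i R)) j k > 0" for j k
    using that arr_verts by (auto simp: reverse_at_def add_paths_def split: if_splits)
  have supp: "j \<in> verts R \<and> k \<in> verts R"
    if "arr (reverse_at i (add_paths i R)) k j < arr (reverse_at i (add_paths i R)) j k" for j k
    using supp0[of j k] that by linarith
  have frz: "arr (reverse_at i (add_paths i R)) j k = 0"
    if "j \<in> frozen R" "k \<in> frozen R" for j k
    using that assms(2) frozen_arr by (auto simp: reverse_at_def add_paths_def mutable_def)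
  show ?thesis
    by unfold_locales (use finite_verts frozen_verts supp frz in \<open>auto simp: arr\<close>)
qed

end

theory Submission
  imports Defs
begin

text \<open>
  Each component of the mutated quiver evolves by its own sequence, and no frozen vertex is ever
  joined to a vertex of another component. Consequently a vertex is green (red) in the whole quiver
  as soon as it is green (red) in its component. The induction needs no sign-coherence: the vertex
  \<open>k\<close> about to be mutated is green in its component because the component's sequence is maximal
  green, so only clause (i) of component preservation can apply, and every arrow into \<open>k\<close> starts
  at a mutable vertex of the component of \<open>k\<close>. New arrows therefore start in that component, and
  they end at a frozen vertex only if it lies there too.
\<close>

section \<open>Components of an ice quiver under mutation\<close>

text \<open>A counterpart of \<open>induced\<close> that keeps track of frozen vertices. The vertex
  type stays the same, so restriction and mutation can be compared by plain equality.\<close>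

definition ice_induced :: "'v ice_quiver \<Rightarrow> 'v set \<Rightarrow> 'v ice_quiver" where
  "ice_induced R B = \<lparr>verts = verts R \<inter> B,
     arr = (\<lambda>a b. if a \<in> B \<and> b \<in> B then arr R a b else 0),
     frozen = frozen R \<inter> B\<rparr>"

text \<open>The invariant that lets colours be read off in components: arrows from \<open>f\<close>
  matter for green, arrows to \<open>f\<close> for red.\<close>

definition frozen_confined :: "'v set set \<Rightarrow> 'v ice_quiver \<Rightarrow> bool" where
  "frozen_confined P R \<longleftrightarrow>
     (\<forall>B\<in>P. \<forall>f\<in>frozen R \<inter> B. \<forall>v. v \<notin> B \<longrightarrow> arr R f v = 0 \<and> arr R v f = 0)"

lemma ice_induced_simps [simp]:
  "verts (ice_induced R B) = verts R \<inter> B"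
  "frozen (ice_induced R B) = frozen R \<inter> B"
  "arr (ice_induced R B) a b = (if a \<in> B \<and> b \<in> B then arr R a b else 0)"
  by (simp_all add: ice_induced_def)

lemma mutable_ice_induced [simp]: "mutable (ice_induced R B) = mutable R \<inter> B"
  by (auto simp: mutable_def)

lemma arr_mutate:
  "arr (mutate i R) j k =
     (let p = (\<lambda>j k. arr R j k + (if j \<in> frozen R \<and> k \<in> frozen R then 0
                else arr R j i * arr R i k));
          r = (\<lambda>j k. if j = i \<or> k = i then p k j else p j k)
      in r j k - r k j)"
  by (simp add: mutate_def cancel_2cycles_def reverse_at_def add_paths_def Let_def)

lemma mutable_mutate [simp]: "mutable (mutate i R) = mutable R"
  by (simp add: mutable_def)

lemma frozen_fold_mutate [simp]: "frozen (fold mutate ks R) = frozen R"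
  by (induction ks arbitrary: R) simp_all

lemma mutable_fold_mutate [simp]: "mutable (fold mutate ks R) = mutable R"
  by (induction ks arbitrary: R) simp_all

lemma ice_quiver_eqI:
  fixes R S :: "'v ice_quiver"
  assumes "verts R = verts S" "frozen R = frozen S" "\<And>a b. arr R a b = arr S a b"
  shows "R = S"
  using assms by (cases R, cases S) (auto simp: fun_eq_iff)

text \<open>The new multiplicity between two vertices depends only on the arrows among these two and
  \<open>k\<close>, all of which lie in \<open>B\<close>.\<close>

lemma ice_induced_mutate_inside:
  assumes "k \<in> B"
  shows "ice_induced (mutate k R) B = mutate k (ice_induced R B)"
proof (rule ice_quiver_eqI)
  fix a b
  show "arr (ice_induced (mutate k R) B) a b = arr (mutate k (ice_induced R B)) a b"
    using assms by (cases "a \<in> B"; cases "b \<in> B") (auto simp: arr_mutate Let_def)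
qed simp_all

text \<open>A path through \<open>k\<close> with both ends in \<open>B\<close> would begin with an
  arrow from \<open>B\<close> to \<open>k\<close>, so nothing is added inside \<open>B\<close>; the
  reversal only affects arrows at \<open>k\<close>.\<close>

lemma ice_induced_mutate_outside:
  assumes "ice_quiver R" "k \<notin> B" "\<And>a. a \<in> B \<Longrightarrow> arr R a k = 0"
  shows "ice_induced (mutate k R) B = ice_induced R B"
proof (rule ice_quiver_eqI)
  interpret ice_quiver R by fact
  fix a b
  \<comment> \<open>Cancellation removes nothing, because \<open>R\<close> has no 2-cycles.\<close>
  have "arr R a b - arr R b a = arr R a b"
    using no_2cycles[of a b] by (cases "arr R a b") auto
  moreover have "a \<noteq> k" "b \<noteq> k" if "a \<in> B" "b \<in> B"
    using that assms(2) by auto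
  ultimately show "arr (ice_induced (mutate k R) B) a b = arr (ice_induced R B) a b"
    using assms(3) by (simp add: arr_mutate Let_def)
qed simp_all

section \<open>Confinement of frozen vertices and colours\<close>

lemma frozen_confinedD:
  assumes "frozen_confined P R" "B \<in> P" "f \<in> frozen R" "f \<in> B" "v \<notin> B"
  shows "arr R f v = 0" "arr R v f = 0"
  using assms unfolding frozen_confined_def by blast+

lemma frozen_confined_mutate:
  assumes "disjoint P" "frozen_confined P R" "C \<in> P" "k \<in> C" "green R k"
    and "\<And>a. arr R a k > 0 \<Longrightarrow> a \<in> C"
  shows "frozen_confined P (mutate k R)"
  unfolding frozen_confined_def
proof (intro ballI allI impI)
  fix B f v
  assume "B \<in> P" "f \<in> frozen (mutate k R) \<inter> B" "v \<notin> B"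
  then have f: "f \<in> frozen R" "f \<in> B" by auto
  note 0 = frozen_confinedD[OF assms(2) \<open>B \<in> P\<close> f]
  \<comment> \<open>Greenness excludes paths from \<open>f\<close> through \<open>k\<close> to
    \<open>v\<close>. A path from \<open>v\<close> through \<open>k\<close> to \<open>f\<close>
    would put \<open>v\<close> in \<open>C\<close> and, by confinement, \<open>k\<close> in
    \<open>B\<close>, so that \<open>B = C\<close> contains \<open>v\<close>.\<close>
  have "arr R f k = 0" "f \<noteq> k"
    using assms(5) f(1) by (auto simp: green_def mutable_def)
  moreover have "arr R v k = 0 \<or> arr R k f = 0"
  proof (rule ccontr)
    assume "\<not> ?thesis"
    then have "v \<in> C" "k \<in> B" using assms(6)[of v] 0(2)[of k] by auto
    then have "B = C" using assms(1,3,4) \<open>B \<in> P\<close> by (auto simp: disjoint_def)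
    with \<open>v \<in> C\<close> \<open>v \<notin> B\<close> show False by simp
  qed
  ultimately show "arr (mutate k R) f v = 0 \<and> arr (mutate k R) v f = 0"
    using 0[OF \<open>v \<notin> B\<close>] by (auto simp: arr_mutate Let_def)
qed

text \<open>A frozen vertex outside \<open>B\<close> lies in another part, and confinement to that
  part excludes an arrow to \<open>k\<close>. Frozen vertices in \<open>B\<close> are handled by the
  colour in the component. \<open>red_of_ice_induced\<close> is the mirror image.\<close>

lemma green_of_ice_induced:
  assumes "frozen_confined P R" "\<Union>P = verts R" "frozen R \<subseteq> verts R" "disjoint P" "B \<in> P"
    and "green (ice_induced R B) k"
  shows "green R k"
  unfolding green_def
proof (intro conjI ballI)
  show "k \<in> mutable R" using assms(6) by (simp add: green_def)
  fix f assume f: "f \<in> frozen R"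
  then obtain C where C: "C \<in> P" "f \<in> C" using assms(2,3) by blast
  show "arr R f k = 0"
    using assms(6) f frozen_confinedD(1)[OF assms(1) C(1) f C(2)] C assms(4,5)
    by (cases "f \<in> B") (auto simp: green_def disjoint_def)
qed

lemma red_of_ice_induced:
  assumes "frozen_confined P R" "\<Union>P = verts R" "frozen R \<subseteq> verts R" "disjoint P" "B \<in> P"
    and "red (ice_induced R B) k"
  shows "red R k"
  unfolding red_def
proof (intro conjI ballI)
  show "k \<in> mutable R" using assms(6) by (simp add: red_def)
  fix f assume f: "f \<in> frozen R"
  then obtain C where C: "C \<in> P" "f \<in> C" using assms(2,3) by blast
  show "arr R k f = 0"
    using assms(6) f frozen_confinedD(2)[OF assms(1) C(1) f C(2)] C assms(4,5)
    by (cases "f \<in> B") (auto simp: red_def disjoint_def)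
qed

text \<open>Clause (ii) asks for an arrow from a frozen vertex to \<open>k\<close>, which greenness
  forbids. Disjointness identifies the part witnessing clause (i) with \<open>B\<close>.\<close>

lemma component_preserving_green:
  assumes "disjoint P" "component_preserving P R k" "green R k" "B \<in> P" "k \<in> B" "arr R a k > 0"
  shows "a \<in> B"
proof -
  obtain C where C: "C \<in> P" "k \<in> C" "\<forall>a. arr R a k > 0 \<longrightarrow> a \<in> C"
    using assms(2,3) unfolding component_preserving_def green_def by auto
  then have "B = C" using assms(1,4,5) by (auto simp: disjoint_def)
  with C(3) assms(6) show ?thesis by simp
qed

section \<open>Induction along the mutation sequence\<close>

text \<open>The hypothesis \<open>gr\<close> concerns only components mutated on their own. The last
  conjunct of the invariant carries it over to \<open>S t\<close>, and the greenness so obtained is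
  what preserves the invariant in the next step.\<close>

lemma component_preserving_fold:
  fixes R :: "'v ice_quiver" and ks :: "'v list"
  defines "S \<equiv> \<lambda>t. fold mutate (take t ks) R"
  assumes R: "ice_quiver R" "disjoint P" "\<Union>P = verts R" "frozen_confined P R"
    and cp: "\<And>t. t < length ks \<Longrightarrow> component_preserving P (S t) (ks ! t)"
    and gr: "\<And>t B. t < length ks \<Longrightarrow> B \<in> P \<Longrightarrow> ks ! t \<in> B \<Longrightarrow>
      green (fold mutate (filter (\<lambda>k. k \<in> B) (take t ks)) (ice_induced R B)) (ks ! t)"
  shows "t \<le> length ks \<Longrightarrow> ice_quiver (S t) \<and> verts (S t) = verts R \<and> frozen_confined P (S t) \<and>
    (\<forall>B\<in>P. ice_induced (S t) B =
       fold mutate (filter (\<lambda>k. k \<in> B) (take t ks)) (ice_induced R B))" (is "_ \<Longrightarrow> ?inv t")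
    and "t < length ks \<Longrightarrow> green (S t) (ks ! t)"
proof -
  have green: "green (S t) (ks ! t)" if inv: "?inv t" and t: "t < length ks" for t
  proof -
    obtain B where B: "B \<in> P" "ks ! t \<in> B"
      using cp[OF t] by (auto simp: component_preserving_def)
    interpret ice_quiver "S t" using inv by simp
    show ?thesis
      using inv gr[OF t B] B frozen_verts R
      by (intro green_of_ice_induced[of P "S t" B]) simp_all
  qed
  have inv: "?inv t" if "t \<le> length ks" for t
    using that
  proof (induction t)
    case 0
    then show ?case using R by (simp add: S_def)
  next
    case (Suc t)
    define k where "k = ks ! t"
    have t: "t < length ks" and IH: "?inv t" using Suc by auto
    have take: "take (Suc t) ks = take t ks @ [k]"
      using t by (simp add: k_def take_Suc_conv_app_nth)
    then have S: "S (Suc t) = mutate k (S t)" by (simp add: S_def)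
    have g: "green (S t) k" using green[OF IH t] by (simp add: k_def)
    have cpk: "component_preserving P (S t) k" using cp[OF t] by (simp add: k_def)
    then obtain C where C: "C \<in> P" "k \<in> C" by (auto simp: component_preserving_def)
    note into = component_preserving_green[OF R(2) cpk g C]
    have "ice_quiver (S (Suc t))"
      unfolding S using IH g by (intro ice_quiver_mutate) (simp_all add: green_def)
    moreover have "frozen_confined P (S (Suc t))"
      unfolding S using frozen_confined_mutate[OF R(2) _ C g into] IH by blast
    moreover have "ice_induced (S (Suc t)) B =
        fold mutate (filter (\<lambda>k. k \<in> B) (take (Suc t) ks)) (ice_induced R B)" if "B \<in> P" for B
    \<comment> \<open>Mutation at \<open>k\<close> is either the next step of the sequence of
      \<open>B\<close> itself, or it leaves the component on \<open>B\<close> unchanged, since all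
      arrows into \<open>k\<close> start in \<open>C\<close>, which is disjoint from
      \<open>B\<close>.\<close>
    proof (cases "k \<in> B")
      case True
      then show ?thesis using IH that by (simp add: S take ice_induced_mutate_inside)
    next
      case False
      then have "B \<inter> C = {}" using R(2) C that by (auto simp: disjoint_def)
      then have "ice_induced (mutate k (S t)) B = ice_induced (S t) B"
        using IH False into by (intro ice_induced_mutate_outside) auto
      then show ?thesis using IH that False by (simp add: S take)
    qed
    ultimately show ?case using IH S by simp
  qed
  then show "t \<le> length ks \<Longrightarrow> ?inv t" .
  show "t < length ks \<Longrightarrow> green (S t) (ks ! t)" using green inv by simp
qed

section \<open>Recovering the sequences from a shuffle\<close>

lemma set_multi_shuffles: "ys \<in> multi_shuffles xss \<Longrightarrow> set ys = (\<Union>xs\<in>set xss. set xs)"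
  by (induction xss arbitrary: ys) (auto simp: set_shuffles)

text \<open>Filtering a shuffle gives a shuffle of the filtered sequences. Here all of these are
  empty except the one at \<open>i\<close>, which is kept whole.\<close>

lemma filter_multi_shuffles:
  assumes "ys \<in> multi_shuffles xss" "i < length xss"
    and "\<And>x. x \<in> set (xss ! i) \<Longrightarrow> p x"
    and "\<And>j x. j < length xss \<Longrightarrow> j \<noteq> i \<Longrightarrow> x \<in> set (xss ! j) \<Longrightarrow> \<not> p x"
  shows "filter p ys = xss ! i"
  using assms
proof (induction xss arbitrary: ys i)
  case Nil
  then show ?case by simp
next
  case (Cons xs xss)
  obtain zs where zs: "zs \<in> multi_shuffles xss" "ys \<in> shuffles xs zs"
    using Cons.prems(1) by auto
  then have f: "filter p ys \<in> shuffles (filter p xs) (filter p zs)"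
    using filter_shuffles by blast
  show ?case
  proof (cases i)
    case 0
    have "\<not> p x" if "x \<in> set zs" for x
      using that set_multi_shuffles[OF zs(1)] Cons.prems(4)[of "Suc _" x] 0
      by (auto simp: in_set_conv_nth[of _ xss])
    then have "filter p zs = []" by simp
    moreover have "filter p xs = xs" using Cons.prems(3) 0 by simp
    ultimately show ?thesis using f 0 by simp
  next
    case (Suc m)
    have "filter p xs = []"
      using Cons.prems(4)[of 0] Suc by simp
    moreover have "filter p zs = xss ! m"
    proof (rule Cons.IH[OF zs(1)])
      show "m < length xss" using Cons.prems(2) Suc by simp
      show "p x" if "x \<in> set (xss ! m)" for x
        using Cons.prems(3) that Suc by simp
      show "\<not> p x" if "j < length xss" "j \<noteq> m" "x \<in> set (xss ! j)" for j x
        using Cons.prems(4)[of "Suc j" x] that Suc by simp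
    qed
    ultimately show ?thesis using f Suc by simp
  qed
qed

text \<open>Translates a time \<open>t\<close> in the shuffle into the time \<open>n\<close> in one
  component's sequence, where \<open>n\<close> counts the earlier entries satisfying
  \<open>p\<close>.\<close>

lemma filter_take_nth:
  assumes "t < length xs" "p (xs ! t)"
  defines "n \<equiv> length (filter p (take t xs))"
  shows "n < length (filter p xs)" "filter p xs ! n = xs ! t"
    "take n (filter p xs) = filter p (take t xs)"
proof -
  have "filter p xs = filter p (take t xs) @ xs ! t # filter p (drop (Suc t) xs)"
    using assms(2) by (subst id_take_nth_drop[OF assms(1)]) simp
  then show "n < length (filter p xs)" "filter p xs ! n = xs ! t"
    "take n (filter p xs) = filter p (take t xs)"
    by (simp_all add: n_def)
qed

section \<open>The framed quiver and its partition\<close>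

lemma mutable_framed: "mutable (framed Q) = Inl ` verts Q"
  by (auto simp: mutable_def framed_def)

text \<open>The arrow from \<open>Inl v\<close> to \<open>Inr v\<close> has both ends in
  \<open>B <+> B\<close> or neither, so framing commutes with restriction.\<close>

lemma framed_induced: "framed (induced Q B) = ice_induced (framed Q) (B <+> B)"
  by (rule ice_quiver_eqI) (auto simp: framed_def induced_def split: sum.splits)

text \<open>Starting data for the induction. Confinement holds because the only arrow at
  \<open>Inr v\<close> comes from \<open>Inl v\<close>, which lies in the same part.\<close>

lemma framed_partition_facts:
  assumes "partition_on (verts Q) P"
  shows "disjoint (framed_partition P)" "\<Union>(framed_partition P) = verts (framed Q)"
    and "frozen_confined (framed_partition P) (framed Q)"
proof -
  show "disjoint (framed_partition P)"
    using partition_onD2[OF assms] by (fastforce simp: disjoint_def framed_partition_def)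
  show "\<Union>(framed_partition P) = verts (framed Q)"
    using partition_onD1[OF assms] by (auto simp: framed_partition_def framed_def)
  show "frozen_confined (framed_partition P) (framed Q)"
    by (auto simp: frozen_confined_def framed_partition_def framed_def split: sum.splits)
qed

section \<open>Assembling the components\<close>

theorem corollary3p12:
  fixes Q :: "'v quiver"
    and \<pi> :: "'v set list"
    and \<sigma> :: "('v + 'v) list list"
    and \<tau> :: "('v + 'v) list"
  assumes "quiver Q"
    and "partition_on (verts Q) (set \<pi>)"
    and "distinct \<pi>"
    and "length \<sigma> = length \<pi>"
    and "\<And>i. i < length \<pi> \<Longrightarrow> maximal_green_sequence (framed (induced Q (\<pi> ! i))) (\<sigma> ! i)"
    and "\<tau> \<in> multi_shuffles \<sigma>"
    and "\<And>t. t < length \<tau> \<Longrightarrow>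
      component_preserving (framed_partition (set \<pi>)) (fold mutate (take t \<tau>) (framed Q)) (\<tau> ! t)"
  shows "maximal_green_sequence (framed Q) \<tau>"
proof -
  let ?P = "framed_partition (set \<pi>)" and ?R = "framed Q"
  let ?B = "\<lambda>i. \<pi> ! i <+> \<pi> ! i"
  note P = framed_partition_facts[OF assms(2)]
  have R: "ice_quiver ?R" using assms(1) by (rule ice_quiver_framed)
  have P_index: "\<exists>i<length \<pi>. B = ?B i" if "B \<in> ?P" for B
    using that by (auto simp: framed_partition_def in_set_conv_nth)
  have \<sigma>: "maximal_green_sequence (ice_induced ?R (?B i)) (\<sigma> ! i)" if "i < length \<pi>" for i
    using assms(5)[OF that] by (simp add: framed_induced)
  have \<sigma>_sub: "set (\<sigma> ! i) \<subseteq> Inl ` (\<pi> ! i)" if "i < length \<pi>" for i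
    using \<sigma>[OF that]
    by (auto simp: maximal_green_sequence_def reddening_sequence_def mutable_framed)
  have filter_\<tau>: "filter (\<lambda>k. k \<in> ?B i) \<tau> = \<sigma> ! i" if i: "i < length \<pi>" for i
  proof (rule filter_multi_shuffles[OF assms(6)])
    show "i < length \<sigma>" using i assms(4) by simp
    show "x \<in> ?B i" if "x \<in> set (\<sigma> ! i)" for x
      using \<sigma>_sub[OF i] that by auto
    show "x \<notin> ?B i" if "j < length \<sigma>" "j \<noteq> i" "x \<in> set (\<sigma> ! j)" for j x
    proof -
      have j: "j < length \<pi>" using that assms(4) by simp
      \<comment> \<open>Distinctness of \<pi> turns different indices into different, hence
        disjoint, parts.\<close>
      then have "\<pi> ! j \<inter> \<pi> ! i = {}"
        using partition_onD2[OF assms(2)] i \<open>j \<noteq> i\<close> assms(3)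
        by (auto simp: disjoint_def nth_eq_iff_index_eq)
      then show ?thesis using \<sigma>_sub[OF j] that by auto
    qed
  qed
  \<comment> \<open>The entries of \<open>take t \<tau>\<close> in \<open>B\<close> form a prefix of
    \<open>\<sigma> ! i\<close>, and \<open>\<tau> ! t\<close> is the entry that follows it, so it
    is green in the component because \<open>\<sigma> ! i\<close> is maximal green.\<close>
  have gr: "green (fold mutate (filter (\<lambda>k. k \<in> B) (take t \<tau>)) (ice_induced ?R B)) (\<tau> ! t)"
    if t: "t < length \<tau>" and B: "B \<in> ?P" "\<tau> ! t \<in> B" for t B
  proof -
    obtain i where i: "i < length \<pi>" "B = ?B i" using P_index[OF B(1)] by blast
    note nth = filter_take_nth[of t \<tau> "\<lambda>k. k \<in> B", OF t B(2)]
    show ?thesis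
      using \<sigma>[OF i(1)] nth filter_\<tau>[OF i(1)]
      unfolding maximal_green_sequence_def i(2) by metis
  qed
  note inv = component_preserving_fold[OF R P assms(7) gr]
  let ?S = "fold mutate \<tau> ?R"
  have S: "ice_quiver ?S" "verts ?S = verts ?R" "frozen_confined ?P ?S"
    and comp: "\<And>B. B \<in> ?P \<Longrightarrow>
      ice_induced ?S B = fold mutate (filter (\<lambda>k. k \<in> B) \<tau>) (ice_induced ?R B)"
    using inv(1)[of "length \<tau>"] by auto
  interpret S: ice_quiver ?S by (rule S(1))
  have "red ?S v" if v: "v \<in> mutable ?S" for v
  proof -
    obtain B where B: "B \<in> ?P" "v \<in> B"
      using v P(2) S(2) by (auto simp: mutable_def)
    obtain i where i: "i < length \<pi>" "B = ?B i" using P_index[OF B(1)] by blast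
    \<comment> \<open>The final component on \<open>B\<close> is the result of all of
      \<open>\<sigma> ! i\<close>, where every mutable vertex is red.\<close>
    have "red (ice_induced ?S B) v"
      using \<sigma>[OF i(1)] comp[OF B(1)] filter_\<tau>[OF i(1)] v B(2)
      by (simp add: maximal_green_sequence_def reddening_sequence_def i(2))
    then show ?thesis
      using red_of_ice_induced[OF S(3) _ S.frozen_verts P(1) B(1)] P(2) S(2) by simp
  qed
  moreover have "set \<tau> \<subseteq> mutable ?R"
    using assms(7) by (auto simp: in_set_conv_nth component_preserving_def)
  ultimately show ?thesis
    using inv(2) by (simp add: maximal_green_sequence_def reddening_sequence_def)
qed

end
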